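(* The parabolic segment $P_n:=\{(x',x_n)\in\mathbb{R}^{n-1}\times\mathbb{R}:\ 0\le x_n\le2(1-\|x'\|^2)\}$ is an $n$-brick.
   Context: $\|\cdot\|$ is the Euclidean norm and $\overline{B}_m$ denotes the closed unit ball of $\mathbb{R}^m$ centered at the origin. An $n$-dimensional semialgebraic set $T\subset\mathbb{R}^n$ is an $m$-brick if there exists a homotopy $H=(H_1,\ldots,H_n):[0,1]\times\overline{B}_m\to T$ such that: (1) each $H_i$ is the restriction to $[0,1]\times\overline{B}_m$ of a polynomial of the ring $\mathcal{C}^0([0,1])[x_1,\ldots,x_m]$, where $\mathcal{C}^0([0,1])$ is the ring of continuous real functions on $[0,1]$; (2) $H(\{0\}\times\overline{B}_m)=T$ and $H(1,\cdot)$ is a constant map; (3) $H(\{t\}\times\overline{B}_m)\subset\operatorname{Int}(T)$ for each $t\in(0,1)$, where $\operatorname{Int}$ is the topological interior in $\mathbb{R}^n$. *)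

theory Defs
  imports "HOL-Analysis.Analysis"
begin

text \<open>Semialgebraic sets: the smallest Boolean algebra of subsets of the ambient space
  that contains all sets \<open>f > 0\<close> with \<open>f\<close> polynomial.\<close>

inductive semialgebraic :: "(real ^ 'n) set \<Rightarrow> bool" where
  positivity: "real_polynomial_function f \<Longrightarrow> semialgebraic {x. f x > 0}"
| union: "semialgebraic A \<Longrightarrow> semialgebraic B \<Longrightarrow> semialgebraic (A \<union> B)"
| complement: "semialgebraic A \<Longrightarrow> semialgebraic (- A)"

text \<open>The dimension of a semialgebraic set is the largest dimension of an open cell that it
  contains (the maximal cell dimension in a decomposition into finitely many cells).
  An open cell of dimension \<open>d\<close> is a semialgebraic set homeomorphic to \<open>\<real>\<close> to the power \<open>d\<close>,
  equivalently to the open cube of dimension \<open>d\<close>.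
  The empty set has no dimension in this sense.\<close>

definition contains_cell :: "(real ^ 'n) set \<Rightarrow> nat \<Rightarrow> bool" where
  "contains_cell S d \<longleftrightarrow>
     (\<exists>C. C \<subseteq> S \<and> semialgebraic C \<and> top_of_set C homeomorphic_space Euclidean_space d)"

definition has_dimension :: "(real ^ 'n) set \<Rightarrow> nat \<Rightarrow> bool" where
  "has_dimension S d \<longleftrightarrow> contains_cell S d \<and> (\<forall>e. contains_cell S e \<longrightarrow> e \<le> d)"

text \<open>\<open>f\<close> agrees on \<open>[0,1] \<times> D\<close> with a polynomial in \<open>x\<close> whose coefficients are continuous
  functions of \<open>t \<in> [0,1]\<close>. The finite set \<open>A\<close> consists of exponent vectors, and \<open>c \<alpha>\<close> is the
  coefficient of the monomial with exponent vector \<open>\<alpha>\<close>; only its values on \<open>[0,1]\<close> matter.\<close>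

definition C0_polynomial_on :: "(real ^ 'm) set \<Rightarrow> (real \<times> (real ^ 'm) \<Rightarrow> real) \<Rightarrow> bool" where
  "C0_polynomial_on D f \<longleftrightarrow>
     (\<exists>(A :: ('m \<Rightarrow> nat) set) (c :: ('m \<Rightarrow> nat) \<Rightarrow> real \<Rightarrow> real).
        finite A \<and> (\<forall>\<alpha>\<in>A. continuous_on {0..1} (c \<alpha>)) \<and>
        (\<forall>t\<in>{0..1}. \<forall>x\<in>D. f (t, x) = (\<Sum>\<alpha>\<in>A. c \<alpha> t * (\<Prod>j\<in>UNIV. (x $ j) ^ \<alpha> j))))"

text \<open>\<open>brick TYPE('m) T\<close> says that \<open>T\<close> is an \<open>m\<close>-brick for \<open>m = CARD('m)\<close>.\<close>

definition brick :: "'m::finite itself \<Rightarrow> (real ^ 'n) set \<Rightarrow> bool" where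
  "brick (_ :: 'm itself) T \<longleftrightarrow>
     semialgebraic T \<and> has_dimension T CARD('n) \<and>
     (\<exists>H :: real \<times> (real ^ 'm) \<Rightarrow> real ^ 'n.
        continuous_on ({0..1} \<times> cball 0 1) H \<and>
        H ` ({0..1} \<times> cball 0 1) \<subseteq> T \<and>
        (\<forall>i. C0_polynomial_on (cball 0 1) (\<lambda>p. H p $ i)) \<and>
        H ` ({0} \<times> cball 0 1) = T \<and>
        (\<exists>a. \<forall>x\<in>cball 0 1. H (1, x) = a) \<and>
        (\<forall>t\<in>{0<..<1}. H ` ({t} \<times> cball 0 1) \<subseteq> interior T))"

text \<open>The coordinate \<open>k\<close> plays the role of the last coordinate, and the remaining ones form
  \<open>x'\<close>. The case \<open>CARD('n) = 1\<close>, in which \<open>x'\<close> is empty and the set is the segment \<open>[0,2]\<close>,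
  is included.\<close>

definition parabolic_segment :: "'n \<Rightarrow> (real ^ 'n) set" where
  "parabolic_segment k =
     {x. 0 \<le> x $ k \<and> x $ k \<le> 2 * (1 - (\<Sum>i\<in>UNIV - {k}. (x $ i)\<^sup>2))}"

end

theory Submission
  imports Defs "HOL-Homology.Invariance_of_Domain"
begin

text \<open>Folding the last coordinate of the ball by squaring it turns the condition
  \<open>\<parallel>x'\<parallel>\<^sup>2 + x\<^sub>n\<^sup>2 \<le> 1\<close> into \<open>0 \<le> y \<le> 2 * (1 - \<parallel>x'\<parallel>\<^sup>2)\<close> for \<open>y = 2 * x\<^sub>n\<^sup>2\<close>. Hence the polynomial
  map \<open>(x', x\<^sub>n) \<mapsto> (x', 2 * x\<^sub>n\<^sup>2)\<close> sends the closed unit ball onto the parabolic segment (lemma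
  \<open>fold_axis_image_cball\<close>). The segment is convex, since it lies below the graph of a concave
  function and above a hyperplane, so the straight-line homotopy from this map to the constant
  map at an interior point \<open>a\<close> (here: the point at height 1 on the last coordinate axis) stays in
  the segment, and at positive times even in its interior. Its coefficients are affine functions
  of the time.

  What remains is the dimension. A set with an interior point contains an open ball, which is a
  cell of full dimension (\<open>contains_cell_if_interior\<close>); a cell of larger dimension would give a continuous injection of
  \<open>\<real>\<^sup>n \<times> \<real>\<close> into \<open>\<real>\<^sup>n\<close>, against invariance of domain
  (\<open>contains_cell_le\<close>).\<close>

section \<open>Semialgebraic sets and their dimension\<close>

lemma semialgebraic_Int:
  assumes "semialgebraic A" and "semialgebraic B"
  shows "semialgebraic (A \<inter> B)"
proof -
  have "semialgebraic (- (- A \<union> - B))"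
    by (intro semialgebraic.intros assms)
  then show ?thesis by simp
qed

lemma semialgebraic_nonneg:
  assumes "real_polynomial_function f"
  shows "semialgebraic {x. 0 \<le> f x}"
proof -
  have "semialgebraic (- {x. 0 < - f x})"
    by (intro semialgebraic.intros real_polynomial_function_minus assms)
  moreover have "- {x. 0 < - f x} = {x. 0 \<le> f x}" by auto
  ultimately show ?thesis by simp
qed

lemma real_polynomial_function_nth:
  "real_polynomial_function (\<lambda>x::real^'n. x $ i)"
  by (intro real_polynomial_function.intros(1) bounded_linear_vec_nth)

lemma semialgebraic_ball: "semialgebraic (ball (a::real^'n) r)"
proof (cases "0 < r")
  case True
  have "ball a r = {x. 0 < r\<^sup>2 - (\<Sum>i\<in>UNIV. (x $ i - a $ i)\<^sup>2)}"
  proof -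
    have "dist a x < r \<longleftrightarrow> 0 < r\<^sup>2 - (\<Sum>i\<in>UNIV. (x $ i - a $ i)\<^sup>2)" for x
    proof -
      have "dist a x < r \<longleftrightarrow> (dist x a)\<^sup>2 < r\<^sup>2"
        using True power_mono_iff[of r "dist x a" 2] by (auto simp: dist_commute simp flip: not_le)
      also have "(dist x a)\<^sup>2 = (\<Sum>i\<in>UNIV. (x $ i - a $ i)\<^sup>2)"
        by (simp add: dist_vec_def L2_set_def sum_nonneg dist_real_def)
      finally show ?thesis by simp
    qed
    then show ?thesis unfolding ball_def by (simp only:)
  qed
  moreover have "real_polynomial_function (\<lambda>x::real^'n. r\<^sup>2 - (\<Sum>i\<in>UNIV. (x $ i - a $ i)\<^sup>2))"
    by (intro real_polynomial_function_diff real_polynomial_function_sum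
        real_polynomial_function_power real_polynomial_function_nth real_polynomial_function.intros(2))
      simp
  ultimately show ?thesis
    by (simp only: semialgebraic.positivity)
next
  case False
  have "semialgebraic {x::real^'n. 0 < (0::real)}"
    by (intro semialgebraic.positivity real_polynomial_function.intros(2))
  with False show ?thesis by (simp add: ball_empty)
qed

lemma contains_cell_if_interior:
  fixes S :: "(real^'n) set"
  assumes "interior S \<noteq> {}"
  shows "contains_cell S CARD('n)"
proof -
  obtain a r where r: "0 < r" "ball a r \<subseteq> S"
    using assms by (auto simp: mem_interior)
  have "ball a r homeomorphic ball (0::real^'n) 1"
    using r by (intro homeomorphic_balls) auto
  also have "ball (0::real^'n) 1 homeomorphic (UNIV :: (real^'n) set)"
    by (rule homeomorphic_ball01_UNIV)
  finally have "top_of_set (ball a r) homeomorphic_space top_of_set (UNIV :: (real^'n) set)"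
    by (simp only: homeomorphic_space_iff_homeomorphic)
  also have "top_of_set (UNIV :: (real^'n) set) homeomorphic_space Euclidean_space CARD('n)"
    by (subst homeomorphic_subspace_Euclidean_space) simp_all
  finally show ?thesis
    unfolding contains_cell_def using r semialgebraic_ball by blast
qed

text \<open>The dimension \<open>e\<close> of the cell is a number that no type represents, so invariance of
  dimension between Euclidean types does not apply to the cell itself. But if \<open>e\<close> exceeds \<open>n\<close>,
  then the cell contains a copy of \<open>\<real>\<^sup>n \<times> \<real>\<close>, which is such a type.\<close>

lemma contains_cell_le:
  fixes S :: "(real^'n) set"
  assumes "contains_cell S e"
  shows "e \<le> CARD('n)"
proof (rule ccontr)
  assume "\<not> e \<le> CARD('n)"
  then have le: "Suc CARD('n) \<le> e" by simp
  obtain C :: "(real^'n) set" where "top_of_set C homeomorphic_space Euclidean_space e"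
    using assms unfolding contains_cell_def by blast
  then obtain h h' where h: "homeomorphic_maps (Euclidean_space e) (top_of_set C) h h'"
    using homeomorphic_space_def homeomorphic_space_sym by blast
  obtain p :: "(nat \<Rightarrow> real) \<Rightarrow> (real^'n) \<times> real" and q
    where pq: "homeomorphic_maps (Euclidean_space (DIM((real^'n) \<times> real))) euclidean p q"
    using homeomorphic_maps_Euclidean_space_euclidean by blast
  have q: "continuous_map euclidean (Euclidean_space (Suc CARD('n))) q" "p (q z) = z" for z
    using pq by (simp_all add: homeomorphic_maps_def del: split_paired_All)
  have sub: "topspace (Euclidean_space (Suc CARD('n))) \<subseteq> topspace (Euclidean_space e)"
    using le by (subst subset_Euclidean_space)
  then have q_in: "q z \<in> topspace (Euclidean_space e)" for z
    using funcset_mem[OF continuous_map_funspace[OF q(1)], of z]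
    by (auto simp only: topspace_euclidean)
  have "Euclidean_space (Suc CARD('n)) =
      subtopology (Euclidean_space e) (topspace (Euclidean_space (Suc CARD('n))))"
    by (metis Euclidean_space_def sub inf.absorb_iff2 subtopology_subtopology topspace_Euclidean_space)
  with q(1) have "continuous_map euclidean (Euclidean_space e) q"
    by (metis continuous_map_into_fulltopology)
  moreover have "continuous_map (Euclidean_space e) euclidean h"
    using h by (auto simp: homeomorphic_maps_def continuous_map_in_subtopology)
  ultimately have "continuous_on UNIV (h \<circ> q)"
    using continuous_map_compose continuous_map_iff_continuous2 by blast
  moreover have "inj (h \<circ> q)"
  proof (rule inj_on_inverseI)
    show "(p \<circ> h') ((h \<circ> q) z) = z" for z
      using h q_in[of z] q(2)[of z] by (simp add: homeomorphic_maps_def)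
  qed
  ultimately have "dim (UNIV :: ((real^'n) \<times> real) set) \<le> dim (UNIV :: (real^'n) set)"
    by (intro invariance_of_dimension_subspaces[where S = UNIV and f = "h \<circ> q"]) auto
  then show False by simp
qed

lemma has_dimension_if_interior:
  fixes S :: "(real^'n) set"
  assumes "interior S \<noteq> {}"
  shows "has_dimension S CARD('n)"
  using contains_cell_if_interior[OF assms] contains_cell_le unfolding has_dimension_def by blast

section \<open>The parabolic segment\<close>

lemma semialgebraic_parabolic_segment:
  "semialgebraic (parabolic_segment (k::'n::finite))"
proof -
  have "real_polynomial_function
      (\<lambda>x::real^'n. 2 * (1 - (\<Sum>i\<in>UNIV - {k}. (x $ i)\<^sup>2)) - x $ k)"
    by (intro real_polynomial_function_diff real_polynomial_function.intros(4)
        real_polynomial_function_sum real_polynomial_function_power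
        real_polynomial_function_nth real_polynomial_function.intros(2)) simp
  from semialgebraic_Int[OF semialgebraic_nonneg[OF real_polynomial_function_nth[of k]]
      semialgebraic_nonneg[OF this]]
  show ?thesis
    by (simp add: parabolic_segment_def Collect_conj_eq)
qed

text \<open>The segment is the part of a half-space on which the convex function
  \<open>x \<mapsto> x\<^sub>n + 2 * \<parallel>x'\<parallel>\<^sup>2\<close> is at most 2.\<close>

lemma convex_parabolic_segment:
  "convex (parabolic_segment (k::'n::finite))"
proof -
  define q where "q = (\<lambda>x::real^'n. x $ k + 2 * (\<Sum>i\<in>UNIV - {k}. (x $ i)\<^sup>2))"
  have q: "q (u *\<^sub>R x + v *\<^sub>R y) \<le> u * q x + v * q y"
    if "0 \<le> u" "0 \<le> v" "u + v = 1" for u v x y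
  proof -
    have "(u * r + v * s)\<^sup>2 \<le> u * r\<^sup>2 + v * s\<^sup>2" for r s :: real
      using convex_power2 that unfolding convex_on_def by fastforce
    then have "(\<Sum>i\<in>UNIV - {k}. (u * x $ i + v * y $ i)\<^sup>2)
        \<le> (\<Sum>i\<in>UNIV - {k}. u * (x $ i)\<^sup>2 + v * (y $ i)\<^sup>2)"
      by (intro sum_mono)
    then show ?thesis
      by (simp add: q_def sum.distrib algebra_simps flip: sum_distrib_left)
  qed
  have eq: "parabolic_segment k = {x. 0 \<le> x $ k \<and> q x \<le> 2}"
    by (auto simp: parabolic_segment_def q_def)
  show ?thesis
    unfolding eq
  proof (rule convexI)
    fix x y :: "real^'n" and u v :: real
    assume *: "x \<in> {x. 0 \<le> x $ k \<and> q x \<le> 2}" "y \<in> {x. 0 \<le> x $ k \<and> q x \<le> 2}"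
      and uv: "0 \<le> u" "0 \<le> v" "u + v = 1"
    have "q (u *\<^sub>R x + v *\<^sub>R y) \<le> u * q x + v * q y" by (rule q[OF uv])
    also have "\<dots> \<le> 2" using * uv by (intro convex_bound_le) auto
    finally show "u *\<^sub>R x + v *\<^sub>R y \<in> {x. 0 \<le> x $ k \<and> q x \<le> 2}"
      using * uv by simp
  qed
qed

lemma axis_in_interior_parabolic_segment:
  "axis k 1 \<in> interior (parabolic_segment (k::'n::finite))"
proof (rule interiorI)
  let ?U = "{x::real^'n. 0 < x $ k \<and> x $ k < 2 * (1 - (\<Sum>i\<in>UNIV - {k}. (x $ i)\<^sup>2))}"
  show "open ?U"
    by (intro open_Collect_conj open_Collect_less continuous_intros)
  have "(\<Sum>i\<in>UNIV - {k}. (axis k (1::real) $ i)\<^sup>2) = 0"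
    by (intro sum.neutral) (auto simp: axis_def)
  then show "axis k 1 \<in> ?U" by simp
  show "?U \<subseteq> parabolic_segment k"
    by (auto simp: parabolic_segment_def)
qed

section \<open>Folding the ball onto the segment and contracting it\<close>

definition fold_axis :: "'n \<Rightarrow> real^'n \<Rightarrow> real^'n" where
  "fold_axis k x = (\<chi> i. if i = k then 2 * (x $ k)\<^sup>2 else x $ i)"

lemma norm_le_1_iff:
  fixes x :: "real^'n"
  shows "norm x \<le> 1 \<longleftrightarrow> (x $ k)\<^sup>2 + (\<Sum>i\<in>UNIV - {k}. (x $ i)\<^sup>2) \<le> 1"
proof -
  have "(x $ k)\<^sup>2 + (\<Sum>i\<in>UNIV - {k}. (x $ i)\<^sup>2) = (\<Sum>i\<in>UNIV. (x $ i)\<^sup>2)"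
    by (simp add: sum.remove[of UNIV k])
  then show ?thesis
    by (simp add: norm_vec_def L2_set_def)
qed

text \<open>A point with last coordinate \<open>y\<close> is hit by the point of the ball with the same \<open>x'\<close> and
  last coordinate \<open>sqrt (y / 2)\<close>.\<close>

lemma fold_axis_image_cball:
  "fold_axis k ` cball 0 1 = parabolic_segment (k::'n::finite)"
proof
  have same: "(\<Sum>i\<in>UNIV - {k}. (fold_axis k x $ i)\<^sup>2) = (\<Sum>i\<in>UNIV - {k}. (x $ i)\<^sup>2)" for x
    by (intro sum.cong) (auto simp: fold_axis_def)
  show "fold_axis k ` cball 0 1 \<subseteq> parabolic_segment k"
    by (auto simp: parabolic_segment_def same norm_le_1_iff[of _ k]) (simp add: fold_axis_def)+
  show "parabolic_segment k \<subseteq> fold_axis k ` cball 0 1"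
  proof
    fix y assume y: "y \<in> parabolic_segment k"
    define x where "x = (\<chi> i. if i = k then sqrt (y $ k / 2) else y $ i)"
    have "0 \<le> y $ k" using y by (simp add: parabolic_segment_def)
    then have fold_x: "fold_axis k x = y" and xk: "(x $ k)\<^sup>2 = y $ k / 2"
      by (auto simp: fold_axis_def x_def vec_eq_iff)
    have "(x $ k)\<^sup>2 + (\<Sum>i\<in>UNIV - {k}. (x $ i)\<^sup>2) \<le> 1"
      using y same[of x] by (simp add: parabolic_segment_def xk fold_x)
    then have "x \<in> cball 0 1" by (simp add: norm_le_1_iff[of _ k])
    with fold_x show "y \<in> fold_axis k ` cball 0 1" by blast
  qed
qed

text \<open>Each coordinate of the folding map is a multiple of a power of one variable, so each
  coordinate of its straight-line contraction has just this power and a term free of \<open>x\<close>.\<close>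

lemma C0_polynomial_on_binomial:
  fixes D :: "(real^'m) set"
  assumes c: "continuous_on {0..1} c" and d: "continuous_on {0..1} d" and p: "0 < p"
    and f: "\<And>t x. f (t, x) = c t * (x $ j) ^ p + d t"
  shows "C0_polynomial_on D f"
proof -
  define \<alpha> where "\<alpha> = (\<lambda>_::'m. 0)(j := p)"
  define c' where "c' = (\<lambda>\<beta>. if \<beta> = \<alpha> then c else d)"
  have "\<alpha> j \<noteq> 0" using p by (simp add: \<alpha>_def)
  then have ne: "\<alpha> \<noteq> (\<lambda>_. 0)" by auto
  have "(\<Prod>i\<in>UNIV. (x $ i) ^ \<alpha> i) = (x $ j) ^ p" for x :: "real^'m"
    by (subst prod.remove[of _ j]) (auto simp: \<alpha>_def)
  then have "f (t, x) = (\<Sum>\<beta>\<in>{\<alpha>, \<lambda>_. 0}. c' \<beta> t * (\<Prod>i\<in>UNIV. (x $ i) ^ \<beta> i))" for t x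
    using ne by (simp add: f c'_def)
  moreover have "\<forall>\<beta>\<in>{\<alpha>, \<lambda>_. 0}. continuous_on {0..1} (c' \<beta>)"
    using c d by (auto simp: c'_def)
  ultimately show ?thesis
    unfolding C0_polynomial_on_def by (intro exI[of _ "{\<alpha>, \<lambda>_. 0}"] exI[of _ c']) auto
qed

theorem lemma2p21:
  fixes k :: "'n::finite"
  shows "brick TYPE('n) (parabolic_segment k)"
proof -
  let ?P = "parabolic_segment k" and ?B = "cball (0::real^'n) 1"
  \<comment> \<open>This is \<open>(1 - t) * f + t * a\<close> for the folding map \<open>f\<close> and the interior point \<open>a\<close>, in the
    form in which points of a convex set are shrunk towards its interior.\<close>
  define H where "H = (\<lambda>(t, x). fold_axis k x - t *\<^sub>R (fold_axis k x - axis k 1))"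
  have int: "H (t, x) \<in> interior ?P" if "x \<in> ?B" "0 < t" "t \<le> 1" for t x
    unfolding H_def prod.case using that fold_axis_image_cball[of k]
    by (intro mem_interior_convex_shrink convex_parabolic_segment
        axis_in_interior_parabolic_segment) auto
  have start: "H ` ({0} \<times> ?B) = ?P"
  proof -
    have "H ` ({0} \<times> ?B) = fold_axis k ` ?B"
      by (force simp: H_def image_iff)
    then show ?thesis by (simp only: fold_axis_image_cball)
  qed
  have "H (t, x) \<in> ?P" if "t \<in> {0..1}" "x \<in> ?B" for t x
  proof (cases "t = 0")
    case True
    then show ?thesis using start that by blast
  next
    case False
    then show ?thesis using int[of x t] that interior_subset by fastforce
  qed
  then have into: "H ` ({0..1} \<times> ?B) \<subseteq> ?P" by auto
  have cont: "continuous_on ({0..1} \<times> ?B) H"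
  proof -
    have "continuous_on UNIV (\<lambda>x. fold_axis k x $ i)" for i
      by (cases "i = k") (auto simp: fold_axis_def intro!: continuous_intros)
    then have "continuous_on UNIV (fold_axis k)"
      using continuous_on_vec_lambda[of UNIV "\<lambda>i x. fold_axis k x $ i"] by simp
    then have "continuous_on ({0..1} \<times> ?B) (\<lambda>z. fold_axis k (snd z))"
      by (rule continuous_on_compose2) (auto intro: continuous_intros)
    then show ?thesis
      unfolding H_def case_prod_beta by (intro continuous_intros)
  qed
  have poly: "C0_polynomial_on ?B (\<lambda>z. H z $ i)" for i
  proof (cases "i = k")
    case True
    show ?thesis
      by (rule C0_polynomial_on_binomial[where c = "\<lambda>t. 2 * (1 - t)" and d = "\<lambda>t. t" and p = 2])
        (auto simp: H_def fold_axis_def True algebra_simps intro!: continuous_intros)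
  next
    case False
    show ?thesis
      by (rule C0_polynomial_on_binomial[where c = "\<lambda>t. 1 - t" and d = "\<lambda>t. 0" and p = 1 and j = i])
        (auto simp: H_def fold_axis_def False axis_def algebra_simps intro!: continuous_intros)
  qed
  show ?thesis
    unfolding brick_def
  proof (intro conjI exI[of _ H])
    show "semialgebraic ?P" by (rule semialgebraic_parabolic_segment)
    show "has_dimension ?P CARD('n)"
      using axis_in_interior_parabolic_segment by (intro has_dimension_if_interior) blast
    show "\<exists>a. \<forall>x\<in>?B. H (1, x) = a" by (simp add: H_def)
  qed (use cont into poly start int in auto)
qed

end
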